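(* Let $H$ be a complex Hilbert space, let $a, b \in E(H)$, and let $x_0 \in E(H)$ lie in the centre of the von Neumann algebra generated by $a$ and $b$, with $\Vert x_0 \Vert < 1$. If $a \triangle_{x_0} b$, then $a$ and $b$ are partially ortho-coexistent.
   Context: $B(H)$ is the algebra of bounded linear operators on $H$, $I$ the identity operator, and $E(H) = \{a \in B(H) : a = a^*,\ 0 \le a \le I\}$ the set of effects. For $u \in B(H)$, $|u| := (u^*u)^{1/2}$. The relation $a \triangle_{x_0} b$ ($a$ is $x_0$-compatible with $b$) means $|a - b| + |I - a - b| = I - x_0$. Effects $a, b \in E(H)$ are partially ortho-coexistent if there exist $x, y, z \in E(H)$ such that $a = x + y$, $b = x + z$, $x + y + z \in E(H)$ and $yz = 0$. *)

theory Defs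
  imports "HOL-Analysis.Analysis"
begin

text \<open>
  Complex Hilbert spaces are the complete members of the following class. The complex inner
  product is conjugate-linear in its first argument. The class extends
  \<^class>\<open>real_inner\<close>, whose real inner product is required to be the real part of the complex
  one; hence the norm (and topology) is the one induced by the complex inner product.
\<close>

class complex_inner = real_inner +
  fixes scaleC :: "complex \<Rightarrow> 'a \<Rightarrow> 'a"  (infixr "*\<^sub>C" 75)
    and cinner :: "'a \<Rightarrow> 'a \<Rightarrow> complex"
  assumes scaleC_add_right: "c *\<^sub>C (x + y) = c *\<^sub>C x + c *\<^sub>C y"
    and scaleC_add_left: "(c + d) *\<^sub>C x = c *\<^sub>C x + d *\<^sub>C x"
    and scaleC_scaleC: "c *\<^sub>C d *\<^sub>C x = (c * d) *\<^sub>C x"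
    and scaleR_scaleC: "r *\<^sub>R x = complex_of_real r *\<^sub>C x"
    and cinner_commute: "cinner x y = cnj (cinner y x)"
    and cinner_add_right: "cinner x (y + z) = cinner x y + cinner x z"
    and cinner_scaleC_right: "cinner x (c *\<^sub>C y) = c * cinner x y"
    and inner_eq_Re_cinner: "inner x y = Re (cinner x y)"

class complex_hilbert_space = complex_inner + complete_space

lemma cinner_self: "cinner x x = complex_of_real ((norm x)\<^sup>2)"
  for x :: "'a::complex_inner"
proof -
  have "Im (cinner x x) = 0"
    using cinner_commute[of x x] by (metis complex_cnj_cancel_iff complex_cnj cnj.simps(2) equal_neg_zero)
  then show ?thesis
    by (simp add: complex_eq_iff power2_norm_eq_inner inner_eq_Re_cinner)
qed

lemma norm_scaleC: "norm (c *\<^sub>C x) = cmod c * norm x"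
  for x :: "'a::complex_inner"
proof -
  have "cinner (c *\<^sub>C x) (c *\<^sub>C x) = c * cnj c * cinner x x"
    by (metis cinner_commute cinner_scaleC_right complex_cnj_mult mult.assoc)
  then have "complex_of_real ((norm (c *\<^sub>C x))\<^sup>2) = complex_of_real ((cmod c * norm x)\<^sup>2)"
    by (simp add: cinner_self complex_norm_square power_mult_distrib del: of_real_power)
  then show ?thesis
    by (metis norm_ge_zero mult_nonneg_nonneg of_real_eq_iff power2_eq_imp_eq)
qed

lemma bounded_linear_scaleC: "bounded_linear (\<lambda>x. c *\<^sub>C x)"
  for c :: complex
proof (rule bounded_linear_intro[where K = "cmod c"])
  show "c *\<^sub>C (r *\<^sub>R x) = r *\<^sub>R (c *\<^sub>C x)" for r and x :: 'a
    by (simp add: scaleR_scaleC scaleC_scaleC mult.commute)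
qed (simp_all add: scaleC_add_right norm_scaleC mult.commute)

text \<open>
  The algebra $B(H)$: the complex-linear ones among the real-linear bounded operators. The norm of
  the latter type is the operator norm.
\<close>

definition cbounded_ops :: "('a::complex_inner \<Rightarrow>\<^sub>L 'a) set" where
  "cbounded_ops = {T. \<forall>c x. blinfun_apply T (c *\<^sub>C x) = c *\<^sub>C T x}"

definition op_scaleC :: "complex \<Rightarrow> ('a::complex_inner \<Rightarrow>\<^sub>L 'a) \<Rightarrow> ('a \<Rightarrow>\<^sub>L 'a)" where
  "op_scaleC c T = Blinfun (\<lambda>x. c *\<^sub>C T x)"

lemma op_scaleC_apply: "blinfun_apply (op_scaleC c T) x = c *\<^sub>C T x"
  unfolding op_scaleC_def
  by (simp add: bounded_linear_Blinfun_apply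
      bounded_linear_compose[OF bounded_linear_scaleC blinfun.bounded_linear_right])

definition op_adj :: "('a::complex_hilbert_space \<Rightarrow>\<^sub>L 'a) \<Rightarrow> ('a \<Rightarrow>\<^sub>L 'a)" where
  "op_adj T = (THE S. S \<in> cbounded_ops \<and> (\<forall>x y. cinner (S x) y = cinner x (T y)))"

definition positive_op :: "('a::complex_hilbert_space \<Rightarrow>\<^sub>L 'a) \<Rightarrow> bool" where
  "positive_op T \<longleftrightarrow> T \<in> cbounded_ops \<and> (\<forall>x. cinner x (T x) \<in> \<real>\<^sub>\<ge>\<^sub>0)"

definition op_le :: "('a::complex_hilbert_space \<Rightarrow>\<^sub>L 'a) \<Rightarrow> ('a \<Rightarrow>\<^sub>L 'a) \<Rightarrow> bool" where
  "op_le S T \<longleftrightarrow> positive_op (T - S)"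

definition op_sqrt :: "('a::complex_hilbert_space \<Rightarrow>\<^sub>L 'a) \<Rightarrow> ('a \<Rightarrow>\<^sub>L 'a)" where
  "op_sqrt T = (THE S. positive_op S \<and> S o\<^sub>L S = T)"

definition op_abs :: "('a::complex_hilbert_space \<Rightarrow>\<^sub>L 'a) \<Rightarrow> ('a \<Rightarrow>\<^sub>L 'a)" where
  "op_abs u = op_sqrt (op_adj u o\<^sub>L u)"

definition effects :: "('a::complex_hilbert_space \<Rightarrow>\<^sub>L 'a) set" where
  "effects = {a \<in> cbounded_ops. a = op_adj a \<and> op_le 0 a \<and> op_le a id_blinfun}"

text \<open>The topology on $B(H)$ induced by the maps $T \mapsto \langle x, T y\rangle$.\<close>

definition weak_operator_topology :: "('a::complex_hilbert_space \<Rightarrow>\<^sub>L 'a) topology" where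
  "weak_operator_topology =
     pullback_topology cbounded_ops (\<lambda>T (x, y). cinner x (blinfun_apply T y)) euclidean"

definition von_neumann_algebra :: "('a::complex_hilbert_space \<Rightarrow>\<^sub>L 'a) set \<Rightarrow> bool" where
  "von_neumann_algebra M \<longleftrightarrow>
     M \<subseteq> cbounded_ops \<and> id_blinfun \<in> M \<and>
     (\<forall>S\<in>M. \<forall>T\<in>M. S + T \<in> M) \<and> (\<forall>c. \<forall>T\<in>M. op_scaleC c T \<in> M) \<and>
     (\<forall>S\<in>M. \<forall>T\<in>M. S o\<^sub>L T \<in> M) \<and> (\<forall>T\<in>M. op_adj T \<in> M) \<and>
     closedin weak_operator_topology M"

definition generated_von_neumann_algebra ::
    "('a::complex_hilbert_space \<Rightarrow>\<^sub>L 'a) set \<Rightarrow> ('a \<Rightarrow>\<^sub>L 'a) set" where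
  "generated_von_neumann_algebra X = \<Inter> {M. von_neumann_algebra M \<and> X \<subseteq> M}"

definition op_centre :: "('a::complex_hilbert_space \<Rightarrow>\<^sub>L 'a) set \<Rightarrow> ('a \<Rightarrow>\<^sub>L 'a) set" where
  "op_centre M = {T \<in> M. \<forall>S\<in>M. T o\<^sub>L S = S o\<^sub>L T}"

definition compatible ::
    "('a::complex_hilbert_space \<Rightarrow>\<^sub>L 'a) \<Rightarrow> ('a \<Rightarrow>\<^sub>L 'a) \<Rightarrow> ('a \<Rightarrow>\<^sub>L 'a) \<Rightarrow> bool" where
  "compatible x0 a b \<longleftrightarrow> op_abs (a - b) + op_abs (id_blinfun - a - b) = id_blinfun - x0"

definition partially_ortho_coexistent ::
    "('a::complex_hilbert_space \<Rightarrow>\<^sub>L 'a) \<Rightarrow> ('a \<Rightarrow>\<^sub>L 'a) \<Rightarrow> bool" where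
  "partially_ortho_coexistent a b \<longleftrightarrow>
     (\<exists>x\<in>effects. \<exists>y\<in>effects. \<exists>z\<in>effects.
        a = x + y \<and> b = x + z \<and> x + y + z \<in> effects \<and> y o\<^sub>L z = 0)"

end

theory Submission
  imports Defs
begin

text \<open>
  Put \<open>u = a - b\<close> and \<open>v = I - a - b\<close>. The orthogonality \<open>y z = 0\<close> forces \<open>y\<close> and \<open>z\<close> to be the
  positive and negative parts of \<open>u\<close>, hence \<open>x = (a + b - |u|) / 2\<close>. The conditions \<open>0 \<le> x\<close> and
  \<open>x + y + z \<le> I\<close> then read \<open>|u| + v \<le> I\<close> and \<open>|u| - v \<le> I\<close>, and both follow from
  \<open>|u| \<plusminus> v \<le> |u| + |v| = I - x\<^sub>0 \<le> I\<close>.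

  Square roots are constructed over the reals. They commute with every real-linear operator that
  commutes with the radicand, in particular with multiplication by \<open>\<i>\<close>, so complex linearity is
  inherited.
\<close>

section \<open>Positive operators on real Hilbert spaces\<close>

definition symmetric_op :: "('a::real_inner \<Rightarrow>\<^sub>L 'a) \<Rightarrow> bool" where
  "symmetric_op T \<longleftrightarrow> (\<forall>x y. inner (T x) y = inner x (T y))"

definition psd_op :: "('a::real_inner \<Rightarrow>\<^sub>L 'a) \<Rightarrow> bool" where
  "psd_op T \<longleftrightarrow> symmetric_op T \<and> (\<forall>x. 0 \<le> inner x (T x))"

lemma symmetric_opD: "symmetric_op T \<Longrightarrow> inner (T x) y = inner x (T y)"
  by (simp add: symmetric_op_def)

lemma psd_op_symmetric: "psd_op T \<Longrightarrow> symmetric_op T"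
  and psd_op_nonneg: "psd_op T \<Longrightarrow> 0 \<le> inner x (T x)"
  by (simp_all add: psd_op_def)

lemma symmetric_op_add: "symmetric_op S \<Longrightarrow> symmetric_op T \<Longrightarrow> symmetric_op (S + T)"
  and symmetric_op_diff: "symmetric_op S \<Longrightarrow> symmetric_op T \<Longrightarrow> symmetric_op (S - T)"
  and symmetric_op_scaleR: "symmetric_op T \<Longrightarrow> symmetric_op (r *\<^sub>R T)"
  and symmetric_op_uminus: "symmetric_op T \<Longrightarrow> symmetric_op (- T)"
  and symmetric_op_id: "symmetric_op id_blinfun"
  and symmetric_op_square: "symmetric_op T \<Longrightarrow> symmetric_op (T o\<^sub>L T)"
  by (simp_all add: symmetric_op_def blinfun.add_left blinfun.diff_left blinfun.scaleR_left
      blinfun.minus_left inner_add_left inner_add_right inner_diff_left inner_diff_right)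

lemma psd_op_add: "psd_op S \<Longrightarrow> psd_op T \<Longrightarrow> psd_op (S + T)"
  by (simp add: psd_op_def symmetric_op_add blinfun.add_left inner_add_right)

lemma psd_op_scaleR: "psd_op T \<Longrightarrow> 0 \<le> r \<Longrightarrow> psd_op (r *\<^sub>R T)"
  by (simp add: psd_op_def symmetric_op_scaleR blinfun.scaleR_left)

lemma psd_op_square: "symmetric_op T \<Longrightarrow> psd_op (T o\<^sub>L T)"
  by (simp add: psd_op_def symmetric_op_square) (metis inner_ge_zero symmetric_opD)

text \<open>The form of \<open>P\<close> at \<open>x - t P x\<close> is a quadratic in
  \<open>t\<close> with zero constant term and linear coefficient \<open>-2 |P x|^2\<close>; it
  stays nonnegative near \<open>t = 0\<close> only if \<open>P x = 0\<close>.\<close>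

lemma psd_op_kernel:
  assumes "psd_op P" and "inner x (P x) = 0"
  shows "P x = 0"
proof (rule ccontr)
  assume "P x \<noteq> 0"
  define p where "p = inner (P x) (P x)"
  define q where "q = inner (P x) (P (P x))"
  have p: "p > 0" using \<open>P x \<noteq> 0\<close> by (simp add: p_def)
  have q: "q \<ge> 0" using assms(1) by (simp add: q_def psd_op_nonneg)
  have *: "0 \<le> t * t * q - 2 * t * p" for t
  proof -
    have "0 \<le> inner (x - t *\<^sub>R P x) (P (x - t *\<^sub>R P x))"
      by (rule psd_op_nonneg[OF assms(1)])
    also have "\<dots> = t * t * q - 2 * t * p"
      using assms(2) symmetric_opD[OF psd_op_symmetric[OF assms(1)], of x "P x"]
      by (simp add: blinfun.diff_right blinfun.scaleR_right inner_diff_left inner_diff_right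
          p_def q_def algebra_simps)
    finally show ?thesis .
  qed
  \<comment> \<open>Small enough that the linear term wins: \<open>t q < p\<close> makes
    \<open>t (t q - 2 p)\<close> negative. The \<open>+ 1\<close> covers
    \<open>q = 0\<close>.\<close>
  define t where "t = p / (q + 1)"
  have t: "t > 0" "t * q < p"
    using p q by (auto simp: t_def field_simps)
  have "t * (t * q - 2 * p) \<ge> 0" using *[of t] by (simp add: algebra_simps)
  then have "t * q \<ge> 2 * p" using t by (simp add: zero_le_mult_iff)
  with t p show False by simp
qed

text \<open>Positivity of \<open>S\<close> and \<open>I - S\<close> yields \<open>S^2 <= S\<close>,
  that is, \<open>|S x|^2 <= <x, S x>\<close>; Cauchy-Schwarz then cancels one factor
  \<open>|S x|\<close>.\<close>

lemma norm_le_one_if_between_0_and_id: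
  assumes "psd_op S" and "psd_op (id_blinfun - S)"
  shows "norm S \<le> 1"
proof (rule norm_blinfun_bound)
  fix x
  \<comment> \<open>\<open>S - S\<^sup>2 = S (I - S) S + (I - S) S (I - S)\<close>\<close>
  have "0 \<le> inner (S x) ((id_blinfun - S) (S x)) + inner (x - S x) (S (x - S x))"
    by (intro add_nonneg_nonneg psd_op_nonneg assms)
  also have "\<dots> = inner x (S x) - inner (S x) (S x)"
    using symmetric_opD[OF psd_op_symmetric[OF assms(1)]]
    by (simp add: blinfun.diff_left blinfun.diff_right inner_diff_left inner_diff_right)
  finally have "inner (S x) (S x) \<le> inner x (S x)" by simp
  also have "\<dots> \<le> norm x * norm (S x)" by (rule norm_cauchy_schwarz)
  finally have "norm (S x) * norm (S x) \<le> norm x * norm (S x)"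
    by (simp add: dot_square_norm power2_eq_square)
  then show "norm (S x) \<le> 1 * norm x"
    by (cases "norm (S x) = 0") (auto simp: mult_le_cancel_right)
qed simp

section \<open>Square roots\<close>

text \<open>
  If \<open>y\<close> is a fixed point of \<open>y \<mapsto> (s + y\<^sup>2) / 2\<close>, then \<open>(1 - y)\<^sup>2 = 1 - s\<close>. The iteration for a
  contraction \<open>S\<close> is dominated in norm by the iteration for the scalar \<open>1\<close>, which is increasing and
  bounded by \<open>1\<close>; so it converges in norm.
\<close>

fun sqrt_iter :: "('a::real_normed_vector \<Rightarrow>\<^sub>L 'a) \<Rightarrow> nat \<Rightarrow> ('a \<Rightarrow>\<^sub>L 'a)" where
  "sqrt_iter S 0 = 0"
| "sqrt_iter S (Suc n) = (1/2) *\<^sub>R (S + (sqrt_iter S n o\<^sub>L sqrt_iter S n))"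

fun sqrt_iter_bound :: "nat \<Rightarrow> real" where
  "sqrt_iter_bound 0 = 0"
| "sqrt_iter_bound (Suc n) = (1 + (sqrt_iter_bound n)\<^sup>2) / 2"

section \<open>Norm convergence of the iteration\<close>

lemma sqrt_iter_bound_range: "0 \<le> sqrt_iter_bound n \<and> sqrt_iter_bound n \<le> 1"
  by (induction n) (auto simp: power_le_one)

lemma convergent_sqrt_iter_bound: "convergent sqrt_iter_bound"
proof (rule Bseq_monoseq_convergent)
  show "Bseq sqrt_iter_bound"
    by (rule BseqI'[where K=1]) (use sqrt_iter_bound_range in \<open>simp add: abs_of_nonneg\<close>)
  \<comment> \<open>With \<open>s\<close> the current term, the increment is
    \<open>(s - 1)^2 / 2\<close>.\<close>
  have "sqrt_iter_bound n \<le> sqrt_iter_bound (Suc n)" for n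
    using zero_le_power2[of "sqrt_iter_bound n - 1"] by (simp add: power2_diff)
  then show "monoseq sqrt_iter_bound"
    by (simp add: mono_SucI1)
qed

lemma norm_sqrt_iter:
  assumes "norm S \<le> 1"
  shows "norm (sqrt_iter S n) \<le> sqrt_iter_bound n"
proof (induction n)
  case (Suc n)
  have "norm (S + (sqrt_iter S n o\<^sub>L sqrt_iter S n))
      \<le> norm S + norm (sqrt_iter S n) * norm (sqrt_iter S n)"
    by (meson norm_triangle_le add_left_mono norm_blinfun_compose)
  also have "\<dots> \<le> 1 + (sqrt_iter_bound n)\<^sup>2"
    unfolding power2_eq_square
    by (intro add_mono mult_mono Suc assms) (use sqrt_iter_bound_range in auto)
  finally show ?case by simp
qed simp

text \<open>Writing \<open>A^2 - B^2 = A (A - B) + (A - B) B\<close> bounds operator increments by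
  scalar ones, since \<open>r^2 - s^2\<close> splits in the same way. The scalar increments
  telescope, which makes the operator series absolutely summable.\<close>

lemma norm_sqrt_iter_step:
  assumes "norm S \<le> 1"
  shows "norm (sqrt_iter S (Suc n) - sqrt_iter S n) \<le> sqrt_iter_bound (Suc n) - sqrt_iter_bound n"
proof (induction n)
  case 0
  then show ?case using assms by simp
next
  case (Suc n)
  define A B where "A = sqrt_iter S (Suc n)" and "B = sqrt_iter S n"
  define r s where "r = sqrt_iter_bound (Suc n)" and "s = sqrt_iter_bound n"
  have IH: "norm (A - B) \<le> r - s"
    using Suc by (simp only: A_def B_def r_def s_def)
  have A: "norm A \<le> r" and B: "norm B \<le> s"
    unfolding A_def B_def r_def s_def by (rule norm_sqrt_iter[OF assms])+
  have "sqrt_iter S (Suc (Suc n)) - A = (1/2) *\<^sub>R ((A o\<^sub>L (A - B)) + ((A - B) o\<^sub>L B))"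
  proof (rule blinfun_eqI)
    fix x
    have "A x = (1/2) *\<^sub>R (S x + B (B x))" for x
      by (simp add: A_def B_def blinfun.add_left blinfun.scaleR_left)
    moreover have "sqrt_iter S (Suc (Suc n)) x = (1/2) *\<^sub>R (S x + A (A x))"
      unfolding A_def by (simp only: sqrt_iter.simps(2)[of S "Suc n"] blinfun.add_left
          blinfun.scaleR_left blinfun_apply_blinfun_compose)
    ultimately have "sqrt_iter S (Suc (Suc n)) x - A x = (1/2) *\<^sub>R (A (A x) - B (B x))"
      by (metis (no_types, lifting) add_diff_cancel_left scaleR_diff_right)
    then show "(sqrt_iter S (Suc (Suc n)) - A) x
        = ((1/2) *\<^sub>R ((A o\<^sub>L (A - B)) + ((A - B) o\<^sub>L B))) x"
      by (simp add: blinfun.add_left blinfun.scaleR_left blinfun.diff_left blinfun.diff_right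
          del: sqrt_iter.simps)
  qed
  then have "norm (sqrt_iter S (Suc (Suc n)) - A)
      = norm ((A o\<^sub>L (A - B)) + ((A - B) o\<^sub>L B)) / 2"
    by simp
  also have "\<dots> \<le> (norm A * norm (A - B) + norm (A - B) * norm B) / 2"
    by (meson norm_triangle_le add_mono norm_blinfun_compose divide_right_mono zero_le_numeral)
  also have "\<dots> \<le> (r * (r - s) + (r - s) * s) / 2"
    using A B IH norm_ge_zero[of A] norm_ge_zero[of B] norm_ge_zero[of "A - B"]
    by (intro divide_right_mono add_mono mult_mono) linarith+
  also have "\<dots> = sqrt_iter_bound (Suc (Suc n)) - r"
  proof -
    have "r = (1 + s\<^sup>2) / 2" and "sqrt_iter_bound (Suc (Suc n)) = (1 + r\<^sup>2) / 2"
      by (simp_all add: r_def s_def)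
    then show ?thesis
      by (simp add: power2_eq_square field_simps)
  qed
  finally show ?case by (simp only: A_def r_def)
qed

lemma symmetric_sqrt_iter: "symmetric_op S \<Longrightarrow> symmetric_op (sqrt_iter S n)"
  by (induction n)
    (auto intro: symmetric_op_scaleR symmetric_op_add symmetric_op_square,
      simp add: symmetric_op_def)

text \<open>Each iterate is a polynomial in \<open>S\<close> with real coefficients, so real
  linearity of \<open>C\<close> suffices.\<close>

lemma commute_sqrt_iter:
  fixes S C :: "'a::real_normed_vector \<Rightarrow>\<^sub>L 'a"
  assumes "\<And>x. C (S x) = S (C x)"
  shows "C (sqrt_iter S n x) = sqrt_iter S n (C x)"
  by (induction n arbitrary: x)
    (simp_all add: assms blinfun.add_left blinfun.scaleR_left blinfun.add_right
      blinfun.scaleR_right blinfun.zero_right)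

lemma convergent_sqrt_iter:
  fixes S :: "'a::banach \<Rightarrow>\<^sub>L 'a"
  assumes "norm S \<le> 1"
  shows "convergent (sqrt_iter S)"
proof -
  have "summable (\<lambda>n. sqrt_iter_bound (Suc n) - sqrt_iter_bound n)"
    using convergent_sqrt_iter_bound telescope_summable[of sqrt_iter_bound]
    unfolding convergent_def by blast
  then have "summable (\<lambda>n. sqrt_iter S (Suc n) - sqrt_iter S n)"
    by (rule summable_comparison_test') (rule norm_sqrt_iter_step[OF assms])
  then have "convergent (\<lambda>n. \<Sum>k<n. sqrt_iter S (Suc k) - sqrt_iter S k)"
    by (simp only: summable_iff_convergent)
  then show ?thesis
    unfolding sum_lessThan_telescope by simp
qed

text \<open>The root is \<open>I - Y\<close>, with \<open>Y\<close> the limit of the iteration for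
  \<open>I - T\<close>. The commutation clause passes to the limit; it later yields both uniqueness
  of the root and its complex linearity.\<close>

lemma psd_sqrt_contraction:
  fixes T :: "'a::{real_inner,banach} \<Rightarrow>\<^sub>L 'a"
  assumes T: "psd_op T" and I: "psd_op (id_blinfun - T)"
  shows "\<exists>R. psd_op R \<and> R o\<^sub>L R = T \<and>
    (\<forall>C. (\<forall>x. blinfun_apply C (T x) = T (C x)) \<longrightarrow> (\<forall>x. C (R x) = R (C x)))"
proof -
  define S where "S = id_blinfun - T"
  have S: "norm S \<le> 1"
    by (rule norm_le_one_if_between_0_and_id) (use T I in \<open>simp_all add: S_def\<close>)
  from convergent_sqrt_iter[OF S] obtain Y where Y: "sqrt_iter S \<longlonglongrightarrow> Y"
    by (auto simp: convergent_def)
  have Yx: "(\<lambda>n. sqrt_iter S n x) \<longlonglongrightarrow> Y x" for x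
    by (intro tendsto_intros Y)
  have fix_Y: "Y = (1/2) *\<^sub>R (S + (Y o\<^sub>L Y))"
  proof (rule LIMSEQ_unique)
    show "(\<lambda>n. sqrt_iter S (Suc n)) \<longlonglongrightarrow> Y"
      by (rule LIMSEQ_Suc[OF Y])
    show "(\<lambda>n. sqrt_iter S (Suc n)) \<longlonglongrightarrow> (1/2) *\<^sub>R (S + (Y o\<^sub>L Y))"
      unfolding sqrt_iter.simps
      by (intro tendsto_intros bounded_bilinear.tendsto[OF bounded_bilinear_blinfun_compose] Y)
  qed
  have norm_Y: "norm Y \<le> 1"
    by (rule LIMSEQ_le_const2[OF tendsto_norm[OF Y]])
      (meson norm_sqrt_iter[OF S] sqrt_iter_bound_range order_trans)
  have "symmetric_op S"
    using I S_def psd_op_symmetric by blast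
  have sym_Y: "symmetric_op Y"
    unfolding symmetric_op_def
  proof (intro allI)
    fix x y
    have "(\<lambda>n. inner (sqrt_iter S n x) y) \<longlonglongrightarrow> inner (Y x) y"
      by (intro tendsto_intros Y)
    moreover have "(\<lambda>n. inner x (sqrt_iter S n y)) \<longlonglongrightarrow> inner x (Y y)"
      by (intro tendsto_intros Y)
    ultimately show "inner (Y x) y = inner x (Y y)"
      using symmetric_opD[OF symmetric_sqrt_iter[OF \<open>symmetric_op S\<close>]]
      by (simp add: LIMSEQ_unique)
  qed
  define R where "R = id_blinfun - Y"
  have "psd_op R"
    unfolding psd_op_def
  proof (intro conjI allI)
    show "symmetric_op R"
      unfolding R_def by (intro symmetric_op_diff symmetric_op_id sym_Y)
    fix x
    have "inner x (Y x) \<le> norm x * norm (Y x)" by (rule norm_cauchy_schwarz)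
    also have "\<dots> \<le> norm x * norm x"
      by (meson mult_left_mono norm_ge_zero norm_blinfun norm_Y mult_left_le_one_le order_trans)
    finally show "0 \<le> inner x (R x)"
      by (simp add: R_def blinfun.diff_left inner_diff_right dot_square_norm power2_eq_square)
  qed
  moreover have "R o\<^sub>L R = T"
  proof (rule blinfun_eqI)
    fix x
    have "2 *\<^sub>R Y x = x - T x + Y (Y x)"
      by (subst fix_Y) (simp add: S_def blinfun.add_left blinfun.scaleR_left blinfun.diff_left)
    then show "(R o\<^sub>L R) x = T x"
      by (simp add: R_def blinfun.diff_left blinfun.diff_right scaleR_2 algebra_simps)
  qed
  moreover have "C (R x) = R (C x)" if C: "\<forall>x. blinfun_apply C (T x) = T (C x)" for C x
  proof -
    have CS: "C (S x) = S (C x)" for x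
      by (simp add: S_def blinfun.diff_left blinfun.diff_right C)
    have "(\<lambda>n. C (sqrt_iter S n x)) \<longlonglongrightarrow> C (Y x)"
      by (intro tendsto_intros Y)
    then have "(\<lambda>n. sqrt_iter S n (C x)) \<longlonglongrightarrow> C (Y x)"
      by (simp add: commute_sqrt_iter[of C S, OF CS])
    with Yx[of "C x"] have "C (Y x) = Y (C x)"
      by (rule LIMSEQ_unique[rotated])
    then show ?thesis
      by (simp add: R_def blinfun.diff_left blinfun.diff_right)
  qed
  ultimately show ?thesis by blast
qed

lemma psd_sqrt_exists:
  fixes T :: "'a::{real_inner,banach} \<Rightarrow>\<^sub>L 'a"
  assumes T: "psd_op T"
  obtains R where "psd_op R" and "R o\<^sub>L R = T"
    and "\<And>C x. (\<And>x. blinfun_apply C (T x) = T (C x)) \<Longrightarrow> C (R x) = R (C x)"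
proof -
  \<comment> \<open>Rescaling brings \<open>T\<close> below the identity; the \<open>+ 1\<close>
    keeps \<open>k\<close> positive when \<open>T = 0\<close>.\<close>
  define k where "k = norm T + 1"
  have k: "k > 0" by (simp add: k_def add_nonneg_pos)
  define T' where "T' = (1/k) *\<^sub>R T"
  have T': "psd_op T'"
    unfolding T'_def using k by (intro psd_op_scaleR T) simp
  have "psd_op (id_blinfun - T')"
    unfolding psd_op_def
  proof (intro conjI allI)
    show "symmetric_op (id_blinfun - T')"
      by (intro symmetric_op_diff symmetric_op_id psd_op_symmetric T')
    fix x
    have "inner x (T x) \<le> norm x * norm (T x)" by (rule norm_cauchy_schwarz)
    also have "\<dots> \<le> norm x * (norm T * norm x)"
      by (intro mult_left_mono norm_blinfun) simp
    also have "\<dots> \<le> k * inner x x"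
      by (simp add: k_def dot_square_norm power2_eq_square algebra_simps)
    finally show "0 \<le> inner x ((id_blinfun - T') x)"
      using k by (simp add: T'_def blinfun.diff_left blinfun.scaleR_left inner_diff_right field_simps)
  qed
  from psd_sqrt_contraction[OF T' this] obtain R' where R': "psd_op R'" "R' o\<^sub>L R' = T'"
    and C': "\<And>C x. (\<And>x. blinfun_apply C (T' x) = T' (C x)) \<Longrightarrow> C (R' x) = R' (C x)"
    by blast
  define R where "R = sqrt k *\<^sub>R R'"
  show thesis
  proof
    show "psd_op R"
      unfolding R_def using k by (intro psd_op_scaleR R') simp
    have "R' (R' x) = (1/k) *\<^sub>R T x" for x
      using R'(2) by (metis T'_def blinfun.scaleR_left blinfun_apply_blinfun_compose)
    then show "R o\<^sub>L R = T"
      using k by (intro blinfun_eqI) (simp add: R_def blinfun.scaleR_left blinfun.scaleR_right)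
    fix C x
    assume "\<And>x. blinfun_apply C (T x) = T (C x)"
    then have "C (R' x) = R' (C x)"
      by (intro C') (simp add: T'_def blinfun.scaleR_left blinfun.scaleR_right)
    then show "C (R x) = R (C x)"
      by (simp add: R_def blinfun.scaleR_left blinfun.scaleR_right)
  qed
qed

text \<open>Commutation gives \<open>(P + R) (P - R) = 0\<close>. For \<open>y = (P - R) x\<close>
  both forms vanish at \<open>y\<close>, hence \<open>P y = R y = 0\<close> and
  \<open>|y|^2 = <x, (P - R) y> = 0\<close>.\<close>

lemma psd_sqrt_unique_commuting:
  assumes P: "psd_op P" and R: "psd_op R"
    and squares: "\<And>x. P (P x) = R (R x)" and commute: "\<And>x. P (R x) = R (P x)"
  shows "P = R"
proof (rule blinfun_eqI)
  fix x
  define y where "y = P x - R x"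
  have "P y + R y = 0"
    by (simp add: y_def blinfun.diff_right squares commute)
  then have "inner y (P y) + inner y (R y) = 0"
    by (metis inner_add_right inner_zero_right)
  then have "inner y (P y) = 0" "inner y (R y) = 0"
    using psd_op_nonneg[OF P, of y] psd_op_nonneg[OF R, of y] by linarith+
  then have "P y = 0" "R y = 0"
    using psd_op_kernel P R by blast+
  moreover have "inner y y = inner x (P y - R y)"
    using symmetric_opD[OF psd_op_symmetric[OF P], of x y]
      symmetric_opD[OF psd_op_symmetric[OF R], of x y]
    by (subst (1) y_def) (simp add: inner_diff_left inner_diff_right)
  ultimately show "P x = R x"
    by (simp add: y_def)
qed

text \<open>\<open>P\<close> and \<open>R\<close> are not assumed to commute with each other, so
  each is compared with the constructed root \<open>Q\<close>, which commutes with everything that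
  commutes with the common square.\<close>

lemma psd_sqrt_unique:
  fixes P :: "'a::{real_inner,banach} \<Rightarrow>\<^sub>L 'a"
  assumes P: "psd_op P" and R: "psd_op R" and squares: "P o\<^sub>L P = R o\<^sub>L R"
  shows "P = R"
proof -
  have sq: "P (P x) = R (R x)" for x
    by (metis squares blinfun_apply_blinfun_compose)
  obtain Q where Q: "psd_op Q" "Q o\<^sub>L Q = R o\<^sub>L R"
    and comm: "\<And>C x. (\<And>x. blinfun_apply C ((R o\<^sub>L R) x) = (R o\<^sub>L R) (C x)) \<Longrightarrow> C (Q x) = Q (C x)"
    by (rule psd_sqrt_exists[OF psd_op_square[OF psd_op_symmetric[OF R]]]) blast
  have Q2: "Q (Q x) = R (R x)" for x
    by (metis Q(2) blinfun_apply_blinfun_compose)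
  have "P (Q x) = Q (P x)" for x
    by (rule comm) (metis sq blinfun_apply_blinfun_compose)
  moreover have "R (Q x) = Q (R x)" for x
    by (rule comm) simp
  ultimately have "P = Q" and "R = Q"
    by (simp_all add: psd_sqrt_unique_commuting P R Q Q2 sq)
  then show ?thesis by simp
qed

section \<open>Comparison of a symmetric operator with its absolute value\<close>

text \<open>
  With \<open>A = R - u\<close> one has \<open>A\<^sup>2 = 2 R A\<close>. Let \<open>M\<close> be the root of \<open>A\<^sup>2\<close> and \<open>D = M - A\<close>, so that
  \<open>D (M + A) = 0\<close>. Multiplying by \<open>D\<close> gives \<open>D M D / 2 = - D R D\<close>; both \<open>D M D\<close> and \<open>D R D\<close> are
  positive, hence zero, and \<open>D = 0\<close> follows, that is, \<open>A = M\<close> is positive.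
\<close>

lemma symmetric_le_abs:
  fixes u :: "'a::{real_inner,banach} \<Rightarrow>\<^sub>L 'a"
  assumes u: "symmetric_op u" and R: "psd_op R"
    and squares: "\<And>x. R (R x) = u (u x)" and comm: "\<And>x. u (R x) = R (u x)"
  shows "psd_op (R - u)"
proof -
  define A where "A = R - u"
  have A: "symmetric_op A"
    unfolding A_def by (intro symmetric_op_diff psd_op_symmetric R u)
  have AR: "A (R x) = R (A x)" and AA: "A (A x) = 2 *\<^sub>R R (A x)" for x
    by (simp_all add: A_def blinfun.diff_left blinfun.diff_right comm squares scaleR_2)
  obtain M where M: "psd_op M" and "M o\<^sub>L M = A o\<^sub>L A"
    and comM: "\<And>C x. (\<And>x. blinfun_apply C ((A o\<^sub>L A) x) = (A o\<^sub>L A) (C x)) \<Longrightarrow> C (M x) = M (C x)"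
    by (rule psd_sqrt_exists[OF psd_op_square[OF A]]) blast
  then have MM: "M (M x) = A (A x)" for x
    by (metis blinfun_apply_blinfun_compose)
  have AM: "A (M x) = M (A x)" and RM: "R (M x) = M (R x)" for x
    by (rule comM, simp add: AR)+
  have "M x = A x" for x
  proof -
    define w where "w = M x - A x"
    \<comment> \<open>This is \<open>(M + A) (M - A) x = 0\<close>, from \<open>M^2 = A^2\<close>
      and \<open>A M = M A\<close>.\<close>
    have Mw: "M w = - A w"
      by (simp add: w_def blinfun.diff_right MM AM)
    have Dw: "M w - A w = 2 *\<^sub>R M w"
      by (simp add: Mw scaleR_2)
    have sym_D: "inner x (M z - A z) = inner (M x - A x) z" for z
      using symmetric_opD[OF psd_op_symmetric[OF M], of x z] symmetric_opD[OF A, of x z]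
      by (simp add: inner_diff_left inner_diff_right)
    \<comment> \<open>The chain moves the symmetric \<open>D = M - A\<close> across the inner
      product and ends in \<open><w, R w> = - <w, M w> / 2\<close>, where both forms are
      nonnegative.\<close>
    have "inner w (R w) = inner x (M (R w) - A (R w))"
      by (simp add: sym_D w_def)
    also have "\<dots> = inner x (R (M w - A w))"
      by (simp add: AR RM blinfun.diff_right)
    also have "\<dots> = - inner x (A (A w))"
      unfolding Dw by (simp add: Mw AA blinfun.scaleR_right blinfun.minus_right)
    also have "A (A w) = (1/2) *\<^sub>R (M (M w) - A (M w))"
    proof -
      have "A (M w) = - A (A w)"
        by (simp add: Mw blinfun.minus_right)
      then show ?thesis by (simp add: MM scaleR_2[symmetric])
    qed
    also have "- inner x \<dots> = - inner w (M w) / 2"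
      using sym_D[of "M w"] by (simp add: w_def)
    finally have "inner w (M w) = 0"
      using psd_op_nonneg[OF R, of w] psd_op_nonneg[OF M, of w] by linarith
    then have "M w = 0"
      by (rule psd_op_kernel[OF M])
    then have "inner w w = 0"
      using sym_D[of w] Dw by (simp add: w_def)
    then show ?thesis by (simp add: w_def)
  qed
  then have "M = A" by (rule blinfun_eqI)
  with M show ?thesis by (simp add: A_def)
qed

section \<open>Complex Hilbert spaces\<close>

instance complex_hilbert_space \<subseteq> banach ..

lemma scaleC_inner_ii: "inner (\<i> *\<^sub>C x) (\<i> *\<^sub>C y) = inner x y"
proof -
  have "cinner (\<i> *\<^sub>C x) (\<i> *\<^sub>C y) = \<i> * cnj (\<i> * cinner y x)"
    by (metis cinner_commute cinner_scaleC_right)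
  then show ?thesis
    using cinner_commute[of x y] by (simp add: inner_eq_Re_cinner)
qed

lemma scaleC_ii_ii: "\<i> *\<^sub>C \<i> *\<^sub>C x = - x"
proof -
  have "\<i> *\<^sub>C \<i> *\<^sub>C x = (- 1) *\<^sub>R x"
    by (simp add: scaleR_scaleC scaleC_scaleC)
  then show ?thesis by simp
qed

text \<open>The real inner product together with multiplication by \<open>\<i>\<close> determines
  the complex one, so complex claims reduce to real ones.\<close>

lemma Im_cinner: "Im (cinner x y) = - inner x (\<i> *\<^sub>C y)"
  by (simp add: inner_eq_Re_cinner cinner_scaleC_right)

lemma cbounded_opsD: "T \<in> cbounded_ops \<Longrightarrow> T (c *\<^sub>C x) = c *\<^sub>C T x"
  by (simp add: cbounded_ops_def)

lemma symmetric_op_cinner: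
  assumes "T \<in> cbounded_ops" and "symmetric_op T"
  shows "cinner (T x) y = cinner x (T y)"
  using assms
  by (simp add: complex_eq_iff inner_eq_Re_cinner[symmetric] Im_cinner symmetric_opD
      cbounded_opsD[symmetric])

text \<open>Over the complex numbers a real quadratic form already forces symmetry: its imaginary
  part vanishes identically, and polarising that with \<open>\<i> y\<close> in place of
  \<open>y\<close> gives \<open><T x, y> = <x, T y>\<close>.\<close>

lemma positive_op_iff: "positive_op T \<longleftrightarrow> T \<in> cbounded_ops \<and> psd_op T"
proof (cases "T \<in> cbounded_ops")
  case True
  have "(\<forall>x. cinner x (T x) \<in> \<real>\<^sub>\<ge>\<^sub>0) \<longleftrightarrow> psd_op T"
  proof
    assume pos: "\<forall>x. cinner x (T x) \<in> \<real>\<^sub>\<ge>\<^sub>0"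
    have im: "inner x (\<i> *\<^sub>C T x) = 0" for x
      using pos Im_cinner[of x "T x"] by (simp add: complex_nonneg_Reals_iff)
    have polar: "inner x (\<i> *\<^sub>C T y) + inner y (\<i> *\<^sub>C T x) = 0" for x y
      using im[of "x + y"] im[of x] im[of y]
      by (simp add: blinfun.add_right scaleC_add_right inner_add_left inner_add_right)
    have "inner (T x) y = inner x (T y)" for x y
      using polar[of x "\<i> *\<^sub>C y"]
      by (simp add: cbounded_opsD[OF True] scaleC_ii_ii scaleC_inner_ii inner_commute)
    then show "psd_op T"
      using pos
      by (simp add: psd_op_def symmetric_op_def inner_eq_Re_cinner complex_nonneg_Reals_iff)
  next
    assume psd: "psd_op T"
    show "\<forall>x. cinner x (T x) \<in> \<real>\<^sub>\<ge>\<^sub>0"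
    proof
      fix x
      have "cinner x (T x) = cnj (cinner x (T x))"
        by (metis True psd cinner_commute psd_op_symmetric symmetric_op_cinner)
      then have "Im (cinner x (T x)) = 0"
        by (metis complex_cnj complex.sel(2) complex.collapse equal_neg_zero)
      with psd_op_nonneg[OF psd, of x] show "cinner x (T x) \<in> \<real>\<^sub>\<ge>\<^sub>0"
        by (simp add: complex_nonneg_Reals_iff inner_eq_Re_cinner)
    qed
  qed
  with True show ?thesis by (simp add: positive_op_def)
qed (simp add: positive_op_def)

section \<open>Adjoints, effects and absolute values via real positivity\<close>

lemma op_adj_symmetric:
  assumes "T \<in> cbounded_ops" and "symmetric_op T"
  shows "op_adj T = T"
  unfolding op_adj_def
proof (rule the_equality)
  show "T \<in> cbounded_ops \<and> (\<forall>x y. cinner (T x) y = cinner x (T y))"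
    using assms symmetric_op_cinner by blast
next
  fix S
  assume "S \<in> cbounded_ops \<and> (\<forall>x y. cinner (S x) y = cinner x (T y))"
  then have "inner (S x) y = inner (T x) y" for x y
    using symmetric_op_cinner[OF assms] by (simp add: inner_eq_Re_cinner)
  then show "S = T"
    by (intro blinfun_eqI) (metis vector_eq_rdot)
qed

lemma cbounded_ops_add: "S \<in> cbounded_ops \<Longrightarrow> T \<in> cbounded_ops \<Longrightarrow> S + T \<in> cbounded_ops"
  by (simp add: cbounded_ops_def blinfun.add_left scaleC_add_right)

lemma cbounded_ops_diff: "S \<in> cbounded_ops \<Longrightarrow> T \<in> cbounded_ops \<Longrightarrow> S - T \<in> cbounded_ops"
  by (simp add: cbounded_ops_def blinfun.diff_left
      linear_diff[OF bounded_linear.linear[OF bounded_linear_scaleC]])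

lemma cbounded_ops_scaleR: "T \<in> cbounded_ops \<Longrightarrow> r *\<^sub>R T \<in> cbounded_ops"
  by (simp add: cbounded_ops_def blinfun.scaleR_left scaleR_scaleC scaleC_scaleC mult.commute)

lemma cbounded_ops_id: "id_blinfun \<in> cbounded_ops"
  by (simp add: cbounded_ops_def)

lemma effects_iff:
  "a \<in> effects \<longleftrightarrow> a \<in> cbounded_ops \<and> psd_op a \<and> psd_op (id_blinfun - a)"
  by (auto simp: effects_def op_le_def positive_op_iff op_adj_symmetric psd_op_symmetric
      cbounded_ops_diff cbounded_ops_id)

lemma op_abs_symmetric:
  fixes u :: "'a::complex_hilbert_space \<Rightarrow>\<^sub>L 'a"
  assumes cu: "u \<in> cbounded_ops" and u: "symmetric_op u"
  shows "op_abs u \<in> cbounded_ops" and "psd_op (op_abs u)"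
    and "op_abs u (op_abs u x) = u (u x)" and "u (op_abs u x) = op_abs u (u x)"
    and "psd_op (op_abs u - u)" and "psd_op (op_abs u + u)"
proof -
  obtain R where R: "psd_op R" and RR: "R o\<^sub>L R = u o\<^sub>L u"
    and comm: "\<And>C x. (\<And>x. blinfun_apply C ((u o\<^sub>L u) x) = (u o\<^sub>L u) (C x)) \<Longrightarrow> C (R x) = R (C x)"
    by (rule psd_sqrt_exists[OF psd_op_square[OF u]]) blast
  have cR: "R \<in> cbounded_ops"
    unfolding cbounded_ops_def
  proof (intro CollectI allI)
    fix c x
    \<comment> \<open>Scalar multiplication by \<open>c\<close> is a bounded real-linear operator
      commuting with \<open>u^2\<close>, hence with the root \<open>R\<close>.\<close>
    define C :: "'a \<Rightarrow>\<^sub>L 'a" where "C = Blinfun (\<lambda>x. c *\<^sub>C x)"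
    have C: "C x = c *\<^sub>C x" for x
      unfolding C_def by (simp add: bounded_linear_Blinfun_apply bounded_linear_scaleC)
    have "C (R x) = R (C x)"
      by (rule comm) (simp add: C cbounded_opsD[OF cu])
    then show "R (c *\<^sub>C x) = c *\<^sub>C R x" by (simp add: C)
  qed
  have "op_abs u = R"
    unfolding op_abs_def op_adj_symmetric[OF cu u] op_sqrt_def
    by (rule the_equality) (simp_all add: positive_op_iff R RR cR psd_sqrt_unique)
  moreover have sq: "R (R x) = u (u x)" for x
    by (metis RR blinfun_apply_blinfun_compose)
  moreover have uR: "u (R x) = R (u x)" for x
    by (rule comm) simp
  \<comment> \<open>\<open>u\<close> and \<open>- u\<close> have the same square, so the comparison
    lemma also applies to \<open>- u\<close>.\<close>
  moreover have "psd_op (R - (- u))"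
    by (rule symmetric_le_abs)
      (simp_all add: symmetric_op_uminus u R sq uR blinfun.minus_left blinfun.minus_right)
  ultimately show "op_abs u \<in> cbounded_ops" and "psd_op (op_abs u)"
    and "op_abs u (op_abs u x) = u (u x)" and "u (op_abs u x) = op_abs u (u x)"
    and "psd_op (op_abs u - u)" and "psd_op (op_abs u + u)"
    using cR R symmetric_le_abs[OF u R sq uR] by simp_all
qed

section \<open>The decomposition of \<open>a\<close> and \<open>b\<close>\<close>

theorem mainTheorem4:
  fixes a b x0 :: "'a::complex_hilbert_space \<Rightarrow>\<^sub>L 'a"
  assumes "a \<in> effects" and "b \<in> effects" and "x0 \<in> effects"
    and "x0 \<in> op_centre (generated_von_neumann_algebra {a, b})"
    and "norm x0 < 1"
    and "compatible x0 a b"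
  shows "partially_ortho_coexistent a b"
proof -
  define u v where "u = a - b" and "v = id_blinfun - a - b"
  define R R' where "R = op_abs u" and "R' = op_abs v"
  note [simp] = blinfun.add_left blinfun.diff_left blinfun.scaleR_left
    blinfun.add_right blinfun.diff_right blinfun.scaleR_right
  have a: "a \<in> cbounded_ops" "psd_op a" "psd_op (id_blinfun - a)"
    and b: "b \<in> cbounded_ops" "psd_op b" "psd_op (id_blinfun - b)"
    and x0: "psd_op x0"
    using assms(1-3) by (simp_all add: effects_iff)
  have u: "u \<in> cbounded_ops" "symmetric_op u" and v: "v \<in> cbounded_ops" "symmetric_op v"
    unfolding u_def v_def
    by (intro cbounded_ops_diff symmetric_op_diff symmetric_op_id psd_op_symmetric cbounded_ops_id a b)+
  note R = op_abs_symmetric[OF u, folded R_def] and R' = op_abs_symmetric[OF v, folded R'_def]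
  have sum: "R + R' = id_blinfun - x0"
    using assms(6) by (simp add: compatible_def R_def R'_def u_def v_def)
  define x y z where "x = (1/2) *\<^sub>R (a + b - R)" and "y = (1/2) *\<^sub>R (R + u)"
    and "z = (1/2) *\<^sub>R (R - u)"
  have [simp]: "x + y = a" "x + z = b"
    unfolding x_def y_def z_def u_def
    by (rule blinfun_eqI, simp add: algebra_simps flip: scaleR_add_left)+
  have cbd: "x \<in> cbounded_ops" "y \<in> cbounded_ops" "z \<in> cbounded_ops"
    unfolding x_def y_def z_def
    by (intro cbounded_ops_scaleR cbounded_ops_add cbounded_ops_diff a b u R)+
  \<comment> \<open>Compatibility trades \<open>- |u|\<close> for \<open>x0 + |v| - I\<close>, which
    exhibits \<open>2 x\<close> as a sum of two positive operators.\<close>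
  have "a + b - R = x0 + (R' - v)"
    using sum by (simp add: v_def algebra_simps)
  then have x: "psd_op x"
    unfolding x_def by (simp add: psd_op_scaleR psd_op_add x0 R')
  have y: "psd_op y" and z: "psd_op z"
    unfolding y_def z_def by (intro psd_op_scaleR R; simp)+
  have "id_blinfun - (x + y + z) = (1/2) *\<^sub>R (x0 + (R' + v))"
  proof -
    have R'_eq: "R' = id_blinfun - x0 - R"
      using sum by (simp add: algebra_simps)
    have "x + y + z = (1/2) *\<^sub>R (a + b + R)"
      unfolding x_def y_def z_def u_def
      by (rule blinfun_eqI) (simp add: algebra_simps flip: scaleR_add_left)
    then show ?thesis
      unfolding v_def R'_eq
      by (intro blinfun_eqI) (simp add: algebra_simps flip: scaleR_add_left)
  qed
  then have I: "psd_op (id_blinfun - (x + y + z))"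
    by (simp add: psd_op_scaleR psd_op_add x0 R')
  have "x + y + z \<in> effects"
    unfolding effects_iff using I
    by (simp only: cbounded_ops_add cbd psd_op_add x y z simp_thms)
  moreover have "x \<in> effects"
  proof -
    \<comment> \<open>The upper bounds on \<open>x\<close>, \<open>y\<close> and \<open>z\<close>
      come from those on \<open>a\<close> and \<open>b\<close>, because the other summand is
      positive.\<close>
    have "id_blinfun - x = (id_blinfun - a) + y" by (simp flip: \<open>x + y = a\<close>)
    then show ?thesis
      using psd_op_add[OF a(3) y] by (simp only: effects_iff cbd x simp_thms)
  qed
  moreover have "y \<in> effects"
  proof -
    have "id_blinfun - y = (id_blinfun - a) + x" by (simp flip: \<open>x + y = a\<close>)
    then show ?thesis
      using psd_op_add[OF a(3) x] by (simp only: effects_iff cbd y simp_thms)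
  qed
  moreover have "z \<in> effects"
  proof -
    have "id_blinfun - z = (id_blinfun - b) + x" by (simp flip: \<open>x + z = b\<close>)
    then show ?thesis
      using psd_op_add[OF b(3) x] by (simp only: effects_iff cbd z simp_thms)
  qed
  \<comment> \<open>Here \<open>4 y z = (R + u) (R - u)\<close>, which vanishes because
    \<open>R\<close> commutes with \<open>u\<close> and \<open>R^2 = u^2\<close>.\<close>
  moreover have "y o\<^sub>L z = 0"
    by (rule blinfun_eqI) (simp add: y_def z_def R(3) R(4))
  ultimately show ?thesis
    unfolding partially_ortho_coexistent_def
    using \<open>x + y = a\<close> \<open>x + z = b\<close> by metis
qed

end
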